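(* Let $\mathbb{F}$ be a field and let $A$ be a countable-dimensional locally matrix algebra over $\mathbb{F}$. Then the Lie algebra $\mathrm{Outder}(A)$ is not locally finite-dimensional.
   Context: An associative $\mathbb{F}$-algebra $A$ (not necessarily with unit) is a locally matrix algebra if every finite subset of $A$ is contained in a subalgebra $B\subset A$ with $B\cong M_n(\mathbb{F})$ for some $n$. Countable-dimensional means of dimension $\aleph_0$ over $\mathbb{F}$. $\mathrm{Der}(A)$ is the Lie algebra of all $\mathbb{F}$-linear derivations of $A$, $\mathrm{Inder}(A)$ is its ideal of inner derivations $x\mapsto[a,x]=ax-xa$, $a\in A$, and $\mathrm{Outder}(A)=\mathrm{Der}(A)/\mathrm{Inder}(A)$. A Lie algebra is locally finite-dimensional if each of its finitely generated subalgebras is finite-dimensional. *)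

theory Defs
  imports "HOL-Library.Countable_Set" "Jordan_Normal_Form.Matrix"
begin

section \<open>Associative algebras, not necessarily with unit\<close>

text \<open>The class \<open>ring\<close> does not postulate a unit.\<close>

locale assoc_algebra = vector_space scale
  for scale :: "'f::field \<Rightarrow> 'a::ring \<Rightarrow> 'a" (infixr \<open>*s\<close> 75) +
  assumes scale_mult_left: "(c *s x) * y = c *s (x * y)"
    and scale_mult_right: "x * (c *s y) = c *s (x * y)"
begin

definition subalgebra :: "'a set \<Rightarrow> bool" where
  "subalgebra B \<longleftrightarrow> subspace B \<and> (\<forall>x\<in>B. \<forall>y\<in>B. x * y \<in> B)"

text \<open>An isomorphism of \<open>B\<close> onto the algebra of \<open>n \<times> n\<close> matrices over the base field.\<close>

definition matrix_iso :: "'a set \<Rightarrow> nat \<Rightarrow> ('a \<Rightarrow> 'f mat) \<Rightarrow> bool" where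
  "matrix_iso B n \<phi> \<longleftrightarrow>
     bij_betw \<phi> B (carrier_mat n n) \<and>
     (\<forall>x\<in>B. \<forall>y\<in>B. \<phi> (x + y) = \<phi> x + \<phi> y) \<and>
     (\<forall>c. \<forall>x\<in>B. \<phi> (c *s x) = c \<cdot>\<^sub>m \<phi> x) \<and>
     (\<forall>x\<in>B. \<forall>y\<in>B. \<phi> (x * y) = \<phi> x * \<phi> y)"

definition countable_dimensional :: bool where
  "countable_dimensional \<longleftrightarrow>
     (\<exists>E. independent E \<and> span E = UNIV \<and> countable E \<and> infinite E)"

definition derivation :: "('a \<Rightarrow> 'a) \<Rightarrow> bool" where
  "derivation D \<longleftrightarrow> Vector_Spaces.linear scale scale D \<and> (\<forall>x y. D (x * y) = D x * y + x * D y)"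

end

locale locally_matrix_algebra = assoc_algebra +
  assumes locally_matrix:
    "finite S \<Longrightarrow> \<exists>B n \<phi>. S \<subseteq> B \<and> subalgebra B \<and> n \<ge> 1 \<and> matrix_iso B n \<phi>"


section \<open>Lie algebras with explicit carrier\<close>

record ('f, 'l) lie_struct =
  lcarrier :: "'l set"
  lzero :: 'l
  ladd :: "'l \<Rightarrow> 'l \<Rightarrow> 'l"
  lscale :: "'f \<Rightarrow> 'l \<Rightarrow> 'l"
  lbracket :: "'l \<Rightarrow> 'l \<Rightarrow> 'l"

locale lie_algebra =
  fixes L :: "('f::field, 'l) lie_struct"
  assumes zero_closed: "lzero L \<in> lcarrier L"
    and add_closed: "\<lbrakk>x \<in> lcarrier L; y \<in> lcarrier L\<rbrakk> \<Longrightarrow> ladd L x y \<in> lcarrier L"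
    and scale_closed: "x \<in> lcarrier L \<Longrightarrow> lscale L c x \<in> lcarrier L"
    and bracket_closed: "\<lbrakk>x \<in> lcarrier L; y \<in> lcarrier L\<rbrakk> \<Longrightarrow> lbracket L x y \<in> lcarrier L"
    and add_assoc: "\<lbrakk>x \<in> lcarrier L; y \<in> lcarrier L; z \<in> lcarrier L\<rbrakk>
      \<Longrightarrow> ladd L (ladd L x y) z = ladd L x (ladd L y z)"
    and add_comm: "\<lbrakk>x \<in> lcarrier L; y \<in> lcarrier L\<rbrakk> \<Longrightarrow> ladd L x y = ladd L y x"
    and add_zero: "x \<in> lcarrier L \<Longrightarrow> ladd L x (lzero L) = x"
    and add_inverse: "x \<in> lcarrier L \<Longrightarrow> \<exists>y\<in>lcarrier L. ladd L x y = lzero L"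
    and scale_add: "\<lbrakk>x \<in> lcarrier L; y \<in> lcarrier L\<rbrakk>
      \<Longrightarrow> lscale L c (ladd L x y) = ladd L (lscale L c x) (lscale L c y)"
    and add_scale: "x \<in> lcarrier L \<Longrightarrow> lscale L (c + d) x = ladd L (lscale L c x) (lscale L d x)"
    and scale_scale: "x \<in> lcarrier L \<Longrightarrow> lscale L c (lscale L d x) = lscale L (c * d) x"
    and scale_one: "x \<in> lcarrier L \<Longrightarrow> lscale L 1 x = x"
    and bracket_add_left: "\<lbrakk>x \<in> lcarrier L; y \<in> lcarrier L; z \<in> lcarrier L\<rbrakk>
      \<Longrightarrow> lbracket L (ladd L x y) z = ladd L (lbracket L x z) (lbracket L y z)"
    and bracket_add_right: "\<lbrakk>x \<in> lcarrier L; y \<in> lcarrier L; z \<in> lcarrier L\<rbrakk>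
      \<Longrightarrow> lbracket L x (ladd L y z) = ladd L (lbracket L x y) (lbracket L x z)"
    and bracket_scale_left: "\<lbrakk>x \<in> lcarrier L; y \<in> lcarrier L\<rbrakk>
      \<Longrightarrow> lbracket L (lscale L c x) y = lscale L c (lbracket L x y)"
    and bracket_scale_right: "\<lbrakk>x \<in> lcarrier L; y \<in> lcarrier L\<rbrakk>
      \<Longrightarrow> lbracket L x (lscale L c y) = lscale L c (lbracket L x y)"
    and bracket_self: "x \<in> lcarrier L \<Longrightarrow> lbracket L x x = lzero L"
    and jacobi: "\<lbrakk>x \<in> lcarrier L; y \<in> lcarrier L; z \<in> lcarrier L\<rbrakk>
      \<Longrightarrow> ladd L (lbracket L x (lbracket L y z))
            (ladd L (lbracket L y (lbracket L z x)) (lbracket L z (lbracket L x y))) = lzero L"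

definition lie_subspace :: "('f, 'l) lie_struct \<Rightarrow> 'l set \<Rightarrow> bool" where
  "lie_subspace L W \<longleftrightarrow> W \<subseteq> lcarrier L \<and> lzero L \<in> W \<and>
     (\<forall>x\<in>W. \<forall>y\<in>W. ladd L x y \<in> W) \<and> (\<forall>c. \<forall>x\<in>W. lscale L c x \<in> W)"

definition lie_subalgebra :: "('f, 'l) lie_struct \<Rightarrow> 'l set \<Rightarrow> bool" where
  "lie_subalgebra L K \<longleftrightarrow> lie_subspace L K \<and> (\<forall>x\<in>K. \<forall>y\<in>K. lbracket L x y \<in> K)"

definition lie_ideal :: "('f, 'l) lie_struct \<Rightarrow> 'l set \<Rightarrow> bool" where
  "lie_ideal L I \<longleftrightarrow> lie_subspace L I \<and> (\<forall>x\<in>lcarrier L. \<forall>y\<in>I. lbracket L x y \<in> I)"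

definition lie_span :: "('f, 'l) lie_struct \<Rightarrow> 'l set \<Rightarrow> 'l set" where
  "lie_span L T = \<Inter>{W. lie_subspace L W \<and> T \<subseteq> W}"

definition lie_generated :: "('f, 'l) lie_struct \<Rightarrow> 'l set \<Rightarrow> 'l set" where
  "lie_generated L S = \<Inter>{K. lie_subalgebra L K \<and> S \<subseteq> K}"

definition lie_finite_dimensional :: "('f, 'l) lie_struct \<Rightarrow> 'l set \<Rightarrow> bool" where
  "lie_finite_dimensional L W \<longleftrightarrow> (\<exists>T. finite T \<and> T \<subseteq> lcarrier L \<and> W = lie_span L T)"

definition locally_finite_dimensional :: "('f, 'l) lie_struct \<Rightarrow> bool" where
  "locally_finite_dimensional L \<longleftrightarrow>
     (\<forall>S. finite S \<and> S \<subseteq> lcarrier L \<longrightarrow> lie_finite_dimensional L (lie_generated L S))"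

definition lie_coset :: "('f, 'l) lie_struct \<Rightarrow> 'l set \<Rightarrow> 'l \<Rightarrow> 'l set" where
  "lie_coset L I x = ladd L x ` I"

text \<open>As with \<open>rcoset_mult\<close> for quotient rings, each operation on cosets is the union of the cosets
  of the results for all representatives; for an ideal all of these coincide
  (see \<open>lie_quotient_simps\<close> below).\<close>

definition lie_quotient :: "('f, 'l) lie_struct \<Rightarrow> 'l set \<Rightarrow> ('f, 'l set) lie_struct" where
  "lie_quotient L I =
     \<lparr>lcarrier = lie_coset L I ` lcarrier L,
      lzero = I,
      ladd = (\<lambda>X Y. \<Union>x\<in>X. \<Union>y\<in>Y. lie_coset L I (ladd L x y)),
      lscale = (\<lambda>c X. \<Union>x\<in>X. lie_coset L I (lscale L c x)),
      lbracket = (\<lambda>X Y. \<Union>x\<in>X. \<Union>y\<in>Y. lie_coset L I (lbracket L x y))\<rparr>"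

lemma UN_eq_const: "a \<in> A \<Longrightarrow> (\<And>x. x \<in> A \<Longrightarrow> f x = C) \<Longrightarrow> (\<Union>x\<in>A. f x) = C"
  by auto

context lie_algebra
begin

lemma add_left_comm:
  assumes "x \<in> lcarrier L" "y \<in> lcarrier L" "z \<in> lcarrier L"
  shows "ladd L x (ladd L y z) = ladd L y (ladd L x z)"
  by (metis assms add_assoc add_comm)

lemma scale_zero_left:
  assumes x: "x \<in> lcarrier L"
  shows "lscale L 0 x = lzero L"
proof -
  let ?z = "lscale L 0 x"
  have z: "?z \<in> lcarrier L" using x by (rule scale_closed)
  have zz: "ladd L ?z ?z = ?z" using add_scale[OF x, of 0 0] by simp
  obtain y where y: "y \<in> lcarrier L" "ladd L ?z y = lzero L" using add_inverse[OF z] by blast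
  show ?thesis using add_assoc[OF z z y(1)] zz y(2) add_zero[OF z] by simp
qed

lemma add_neg:
  assumes x: "x \<in> lcarrier L"
  shows "ladd L x (lscale L (- 1) x) = lzero L"
  using add_scale[OF x, of 1 "- 1"] scale_one[OF x] scale_zero_left[OF x] by simp

context
  fixes I
  assumes ideal: "lie_ideal L I"
begin

lemma ideal_carrier: "i \<in> I \<Longrightarrow> i \<in> lcarrier L"
  and ideal_zero: "lzero L \<in> I"
  and ideal_add: "i \<in> I \<Longrightarrow> j \<in> I \<Longrightarrow> ladd L i j \<in> I"
  and ideal_scale: "i \<in> I \<Longrightarrow> lscale L c i \<in> I"
  and ideal_bracket: "x \<in> lcarrier L \<Longrightarrow> i \<in> I \<Longrightarrow> lbracket L x i \<in> I"
  using ideal unfolding lie_ideal_def lie_subspace_def by auto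

lemma ideal_bracket':
  assumes x: "x \<in> lcarrier L" and i: "i \<in> I"
  shows "lbracket L i x \<in> I"
proof -
  have ic: "i \<in> lcarrier L" using i by (rule ideal_carrier)
  have s: "ladd L x i \<in> lcarrier L" using x ic by (rule add_closed)
  have ix: "lbracket L i x \<in> lcarrier L" and xi: "lbracket L x i \<in> lcarrier L"
    and z: "lzero L \<in> lcarrier L"
    using x ic by (auto intro: bracket_closed zero_closed)
  have "lzero L = ladd L (lbracket L x (ladd L x i)) (lbracket L i (ladd L x i))"
    using bracket_self[OF s] bracket_add_left[OF x ic s] by simp
  also have "\<dots> = ladd L (lbracket L x i) (lbracket L i x)"
    using bracket_add_right[OF x x ic] bracket_add_right[OF ic x ic] bracket_self[OF x]
      bracket_self[OF ic] add_zero[OF ix] add_zero[OF xi] add_comm[OF z xi] by simp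
  finally have sum0: "ladd L (lbracket L x i) (lbracket L i x) = lzero L" by simp
  let ?n = "lscale L (- 1) (lbracket L x i)"
  have n: "?n \<in> lcarrier L" using xi by (rule scale_closed)
  have "lbracket L i x = ladd L (lbracket L i x) (ladd L (lbracket L x i) ?n)"
    using add_neg[OF xi] add_zero[OF ix] by simp
  also have "\<dots> = ladd L (ladd L (lbracket L x i) (lbracket L i x)) ?n"
    using add_assoc[OF ix xi n] add_comm[OF ix xi] by simp
  also have "\<dots> = ?n"
    using sum0 add_comm[OF z n] add_zero[OF n] by simp
  finally show ?thesis using ideal_scale[OF ideal_bracket[OF x i]] by metis
qed

lemma coset_self: "x \<in> lcarrier L \<Longrightarrow> x \<in> lie_coset L I x"
  unfolding lie_coset_def using ideal_zero add_zero by force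

lemma coset_shift:
  assumes x: "x \<in> lcarrier L" and i: "i \<in> I"
  shows "lie_coset L I (ladd L x i) = lie_coset L I x"
proof
  have ic: "i \<in> lcarrier L" using i by (rule ideal_carrier)
  show "lie_coset L I (ladd L x i) \<subseteq> lie_coset L I x"
    unfolding lie_coset_def using add_assoc[OF x ic] ideal_add[OF i] ideal_carrier by auto
  show "lie_coset L I x \<subseteq> lie_coset L I (ladd L x i)"
  proof
    fix y assume "y \<in> lie_coset L I x"
    then obtain j where j: "j \<in> I" "y = ladd L x j" unfolding lie_coset_def by auto
    let ?n = "lscale L (- 1) i"
    have n: "?n \<in> I" "?n \<in> lcarrier L" and jc: "j \<in> lcarrier L"
      using i j ideal_scale ideal_carrier by auto
    have k: "ladd L ?n j \<in> I" using n j ideal_add by auto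
    have "ladd L i (ladd L ?n j) = j"
      using add_assoc[OF ic n(2) jc] add_neg[OF ic] add_zero[OF jc] add_comm[OF zero_closed jc]
      by simp
    hence "y = ladd L (ladd L x i) (ladd L ?n j)"
      using j(2) add_assoc[OF x ic ideal_carrier[OF k]] by simp
    thus "y \<in> lie_coset L I (ladd L x i)" unfolding lie_coset_def using k by auto
  qed
qed

lemma coset_zero: "lie_coset L I (lzero L) = I"
proof -
  have "ladd L (lzero L) i = i" if "i \<in> I" for i
    using add_comm[OF zero_closed ideal_carrier[OF that]] add_zero[OF ideal_carrier[OF that]]
    by simp
  thus ?thesis unfolding lie_coset_def by force
qed

lemma quotient_carrier: "lcarrier (lie_quotient L I) = lie_coset L I ` lcarrier L"
  and quotient_zero: "lzero (lie_quotient L I) = lie_coset L I (lzero L)"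
  by (simp_all add: lie_quotient_def coset_zero)

lemma quotient_add:
  assumes x: "x \<in> lcarrier L" and y: "y \<in> lcarrier L"
  shows "ladd (lie_quotient L I) (lie_coset L I x) (lie_coset L I y) = lie_coset L I (ladd L x y)"
proof -
  have *: "lie_coset L I (ladd L a b) = lie_coset L I (ladd L x y)"
    if ab: "a \<in> lie_coset L I x" "b \<in> lie_coset L I y" for a b
  proof -
    obtain i j where ij: "i \<in> I" "j \<in> I" "a = ladd L x i" "b = ladd L y j"
      using ab unfolding lie_coset_def by auto
    have c: "i \<in> lcarrier L" "j \<in> lcarrier L" using ij ideal_carrier by auto
    have "ladd L a b = ladd L (ladd L x y) (ladd L i j)"
      unfolding ij using x y c by (simp add: add_assoc add_left_comm add_closed)
    thus ?thesis using coset_shift[OF add_closed[OF x y] ideal_add[OF ij(1,2)]] by simp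
  qed
  show ?thesis unfolding lie_quotient_def lie_struct.simps
    by (intro UN_eq_const[OF coset_self[OF x]] UN_eq_const[OF coset_self[OF y]] *)
qed

lemma quotient_scale:
  assumes x: "x \<in> lcarrier L"
  shows "lscale (lie_quotient L I) c (lie_coset L I x) = lie_coset L I (lscale L c x)"
proof -
  have *: "lie_coset L I (lscale L c a) = lie_coset L I (lscale L c x)"
    if a: "a \<in> lie_coset L I x" for a
  proof -
    obtain i where i: "i \<in> I" "a = ladd L x i" using a unfolding lie_coset_def by auto
    show ?thesis unfolding i(2) scale_add[OF x ideal_carrier[OF i(1)]]
      by (rule coset_shift[OF scale_closed[OF x] ideal_scale[OF i(1)]])
  qed
  show ?thesis unfolding lie_quotient_def lie_struct.simps
    by (intro UN_eq_const[OF coset_self[OF x]] *)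
qed

lemma quotient_bracket:
  assumes x: "x \<in> lcarrier L" and y: "y \<in> lcarrier L"
  shows "lbracket (lie_quotient L I) (lie_coset L I x) (lie_coset L I y)
    = lie_coset L I (lbracket L x y)"
proof -
  have *: "lie_coset L I (lbracket L a b) = lie_coset L I (lbracket L x y)"
    if ab: "a \<in> lie_coset L I x" "b \<in> lie_coset L I y" for a b
  proof -
    obtain i j where ij: "i \<in> I" "j \<in> I" "a = ladd L x i" "b = ladd L y j"
      using ab unfolding lie_coset_def by auto
    have c: "i \<in> lcarrier L" "j \<in> lcarrier L" using ij ideal_carrier by auto
    have a: "a \<in> lcarrier L" unfolding ij using x c by (simp add: add_closed)
    have "lbracket L a b = ladd L (lbracket L a y) (lbracket L a j)"
      unfolding ij(4) by (rule bracket_add_right[OF a y c(2)])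
    also have "\<dots> = ladd L (ladd L (lbracket L x y) (lbracket L i y)) (lbracket L a j)"
      using bracket_add_left[OF x c(1) y] ij(3) by simp
    finally show ?thesis
      using coset_shift ideal_bracket[OF a ij(2)] ideal_bracket'[OF y ij(1)]
        bracket_closed[OF x y] bracket_closed[OF c(1) y] add_closed by simp
  qed
  show ?thesis unfolding lie_quotient_def lie_struct.simps
    by (intro UN_eq_const[OF coset_self[OF x]] UN_eq_const[OF coset_self[OF y]] *)
qed

lemmas lie_quotient_simps =
  quotient_carrier quotient_zero quotient_add quotient_scale quotient_bracket

lemma lie_algebra_quotient: "lie_algebra (lie_quotient L I)"
proof
  fix X assume "X \<in> lcarrier (lie_quotient L I)"
  then obtain x where x: "x \<in> lcarrier L" "X = lie_coset L I x" by (auto simp: quotient_carrier)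
  show "\<exists>Y\<in>lcarrier (lie_quotient L I). ladd (lie_quotient L I) X Y = lzero (lie_quotient L I)"
    unfolding x(2) lie_quotient_simps
    by (rule bexI[of _ "lie_coset L I (lscale L (- 1) x)"])
      (simp_all add: x lie_quotient_simps scale_closed add_neg)
next
  fix X Y assume "X \<in> lcarrier (lie_quotient L I)" "Y \<in> lcarrier (lie_quotient L I)"
  then obtain x y where "x \<in> lcarrier L" "X = lie_coset L I x" "y \<in> lcarrier L" "Y = lie_coset L I y"
    by (auto simp: quotient_carrier)
  thus "ladd (lie_quotient L I) X Y = ladd (lie_quotient L I) Y X"
    using add_comm[of x y] by (simp add: quotient_add)
next
  fix X Y Z assume "X \<in> lcarrier (lie_quotient L I)" "Y \<in> lcarrier (lie_quotient L I)"
    "Z \<in> lcarrier (lie_quotient L I)"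
  thus "ladd (lie_quotient L I)
          (lbracket (lie_quotient L I) X (lbracket (lie_quotient L I) Y Z))
          (ladd (lie_quotient L I)
            (lbracket (lie_quotient L I) Y (lbracket (lie_quotient L I) Z X))
            (lbracket (lie_quotient L I) Z (lbracket (lie_quotient L I) X Y)))
        = lzero (lie_quotient L I)"
    by (auto simp: lie_quotient_simps add_closed bracket_closed jacobi)
qed (auto simp: lie_quotient_simps zero_closed add_closed scale_closed bracket_closed
      add_assoc add_zero scale_add add_scale scale_scale scale_one bracket_add_left
      bracket_add_right bracket_scale_left bracket_scale_right bracket_self)

end

end


section \<open>The Lie algebras of derivations and of outer derivations\<close>

context assoc_algebra
begin

definition Der :: "('f, 'a \<Rightarrow> 'a) lie_struct" where
  "Der = \<lparr>lcarrier = {D. derivation D},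
          lzero = (\<lambda>x. 0),
          ladd = (\<lambda>D E x. D x + E x),
          lscale = (\<lambda>c D x. c *s D x),
          lbracket = (\<lambda>D E x. D (E x) - E (D x))\<rparr>"

definition Inder :: "('a \<Rightarrow> 'a) set" where
  "Inder = {\<lambda>x. a * x - x * a | a. True}"

definition Outder :: "('f, ('a \<Rightarrow> 'a) set) lie_struct" where
  "Outder = lie_quotient Der Inder"

lemma derivation_iff:
  "derivation D \<longleftrightarrow> (\<forall>x y. D (x + y) = D x + D y) \<and> (\<forall>c x. D (c *s x) = c *s D x) \<and>
     (\<forall>x y. D (x * y) = D x * y + x * D y)"
  unfolding derivation_def Vector_Spaces.linear_iff
  by (auto simp: vector_space_axioms)

lemma derivation_diff: "derivation D \<Longrightarrow> D (x - y) = D x - D y"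
  unfolding derivation_iff by (metis add_diff_cancel diff_add_cancel)

lemma lie_algebra_Der: "lie_algebra Der"
proof
  fix D assume D: "D \<in> lcarrier Der"
  show "\<exists>E\<in>lcarrier Der. ladd Der D E = lzero Der"
    by (rule bexI[of _ "\<lambda>x. - D x"])
      (use D in \<open>auto simp: Der_def derivation_iff fun_eq_iff\<close>)
qed (auto simp: Der_def derivation_iff derivation_diff[unfolded derivation_iff] fun_eq_iff
      algebra_simps scale_mult_left scale_mult_right scale_right_distrib scale_left_distrib
      scale_right_diff_distrib)

lemma lie_ideal_Inder: "lie_ideal Der Inder"
  unfolding lie_ideal_def lie_subspace_def
proof (intro conjI ballI allI subsetI)
  fix D assume "D \<in> Inder"
  thus "D \<in> lcarrier Der"
    by (auto simp: Inder_def Der_def derivation_iff algebra_simps scale_mult_left scale_mult_right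
        scale_right_diff_distrib)
next
  show "lzero Der \<in> Inder"
    by (auto simp: Inder_def Der_def intro!: exI[of _ 0])
next
  fix D E assume "D \<in> Inder" "E \<in> Inder"
  then obtain a b where DE: "D = (\<lambda>x. a * x - x * a)" "E = (\<lambda>x. b * x - x * b)"
    by (auto simp: Inder_def)
  have "ladd Der D E = (\<lambda>x. (a + b) * x - x * (a + b))"
    by (simp add: DE Der_def algebra_simps)
  thus "ladd Der D E \<in> Inder" unfolding Inder_def by blast
next
  fix c D assume "D \<in> Inder"
  then obtain a where "D = (\<lambda>x. a * x - x * a)" by (auto simp: Inder_def)
  thus "lscale Der c D \<in> Inder"
    by (auto simp: Inder_def Der_def fun_eq_iff scale_mult_left scale_mult_right
        scale_right_diff_distrib intro!: exI[of _ "c *s a"])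
next
  fix D E assume D: "D \<in> lcarrier Der" and "E \<in> Inder"
  then obtain a where E: "E = (\<lambda>x. a * x - x * a)" by (auto simp: Inder_def)
  have "derivation D" using D by (simp add: Der_def)
  hence "lbracket Der D E = (\<lambda>x. D a * x - x * D a)"
    by (simp add: E Der_def derivation_diff) (simp add: derivation_iff algebra_simps)
  thus "lbracket Der D E \<in> Inder" unfolding Inder_def by blast
qed

lemma lie_algebra_Outder: "lie_algebra Outder"
  unfolding Outder_def
  by (rule lie_algebra.lie_algebra_quotient[OF lie_algebra_Der lie_ideal_Inder])

end

end

theory Submission
  imports Defs
begin

text \<open>
  The failure of local finiteness is witnessed by two derivations, each an infinite sum of inner ones.

  Suppose that \<open>A\<close> contains, for every \<open>i\<close>, a system \<open>U i\<close> of \<open>(i + 1) \<times> (i + 1)\<close> matrix units such that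
  different systems commute with each other and every element of \<open>A\<close> commutes with all but finitely
  many systems. Any choice of \<open>c i\<close> in the span of \<open>U i\<close> then gives a derivation \<open>\<Sum>i. ad (c i)\<close>,
  since the sum is finite at every argument, and because different systems commute the bracket of
  two such derivations is computed term by term (\<open>bracket_sum_ad\<close>). Take for \<open>a i\<close> the sum of the units
  just below the diagonal, for \<open>b i\<close> the unit in the top right corner, and put \<open>D = \<Sum>i. ad (a i)\<close>,
  \<open>E = \<Sum>i. ad (b i)\<close>. The Lie algebra generated by \<open>D\<close> and \<open>E\<close> contains
  \<open>\<Sum>i. ad (ad (a i) ^ m (b i))\<close> for all \<open>m\<close>, and these are linearly independent modulo inner
  derivations: an element \<open>z\<close> of \<open>A\<close> commutes with \<open>U i\<close> for all large \<open>i\<close>, so if a combination were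
  \<open>ad z\<close>, the corresponding combination of the elements \<open>ad (a i) ^ m (b i)\<close> would commute with a
  diagonal matrix unit of \<open>U i\<close>; for \<open>i\<close> large this forces all coefficients to vanish
  (\<open>iterated_independent\<close>).

  The systems \<open>U i\<close> are chosen recursively, each commuting with the earlier ones and with the first \<open>i\<close>
  members of a countable basis. So what has to be shown is that a finite set \<open>S\<close> commutes with
  arbitrarily large systems of matrix units (\<open>matrix_units_commuting\<close>). Let \<open>F\<close> be \<open>n \<times> n\<close> matrix units
  whose span contains \<open>S\<close>, with unit element \<open>e\<close>, and embed \<open>F\<close> into a matrix algebra of much larger size
  \<open>N\<close>. On its column space, of dimension \<open>N\<close>, the \<open>n + 1\<close> orthogonal idempotents \<open>F 0 0\<close>, ...,
  \<open>F (n - 1) (n - 1)\<close>, \<open>1 - e\<close> add up to the identity, so one of them has large rank and its corner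
  contains a large system of matrix units. For \<open>1 - e\<close> these units annihilate \<open>F\<close>; for \<open>F p p\<close> they are
  copied diagonally, \<open>x \<mapsto> \<Sum>c. F c p * x * F p c\<close>, into the centralizer of \<open>F\<close>. In this way
  algebras with a unit and without one are treated alike.
\<close>

section \<open>Matrix units\<close>

definition matrix_units :: "nat \<Rightarrow> (nat \<Rightarrow> nat \<Rightarrow> 'a::ring) \<Rightarrow> bool" where
  "matrix_units n F \<longleftrightarrow>
     (\<forall>a<n. \<forall>b<n. \<forall>c<n. \<forall>d<n. F a b * F c d = (if b = c then F a d else 0)) \<and>
     (\<forall>a<n. F a a \<noteq> 0)"

lemma matrix_units_mult:
  assumes "matrix_units n F" "a < n" "b < n" "c < n" "d < n"
  shows "F a b * F c d = (if b = c then F a d else 0)"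
  using assms by (simp add: matrix_units_def)

lemma matrix_units_mult':
  assumes "matrix_units n F" "a < n" "b < n" "c < n" "d < n"
  shows "F a b * (F c d * x) = (if b = c then F a d * x else 0)"
  using matrix_units_mult[OF assms] by (simp add: mult.assoc[symmetric])

lemma matrix_units_nonzero: "matrix_units n F \<Longrightarrow> a < n \<Longrightarrow> F a a \<noteq> 0"
  by (simp add: matrix_units_def)

context assoc_algebra
begin

text \<open>The matrix units are the preimages of the elementary matrices; an element of \<open>B\<close> is recovered
  from the entries of its image because \<open>\<phi>\<close> is injective.\<close>

lemma matrix_iso_matrix_units:
  assumes B: "subalgebra B" and \<phi>: "matrix_iso B n \<phi>"
  obtains F where "matrix_units n F" "B = span ((\<lambda>(a, b). F a b) ` ({..<n} \<times> {..<n}))"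
proof -
  have bij: "bij_betw \<phi> B (carrier_mat n n)"
    and add: "\<And>x y. x \<in> B \<Longrightarrow> y \<in> B \<Longrightarrow> \<phi> (x + y) = \<phi> x + \<phi> y"
    and scl: "\<And>c x. x \<in> B \<Longrightarrow> \<phi> (c *s x) = c \<cdot>\<^sub>m \<phi> x"
    and mul: "\<And>x y. x \<in> B \<Longrightarrow> y \<in> B \<Longrightarrow> \<phi> (x * y) = \<phi> x * \<phi> y"
    using \<phi> by (auto simp: matrix_iso_def)
  have sub: "subspace B" and mB: "\<And>x y. x \<in> B \<Longrightarrow> y \<in> B \<Longrightarrow> x * y \<in> B"
    using B by (auto simp: subalgebra_def)
  have carr: "\<phi> x \<in> carrier_mat n n" if "x \<in> B" for x
    using bij that by (auto simp: bij_betw_def)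
  have inj: "x = y" if "x \<in> B" "y \<in> B" "\<phi> x = \<phi> y" for x y
    using bij that by (auto simp: bij_betw_def inj_on_def)
  have zB: "0 \<in> B" using sub by (rule subspace_0)
  have "\<phi> 0 = 0 \<cdot>\<^sub>m \<phi> 0" using scl[OF zB, of 0] by simp
  also have "\<dots> = 0\<^sub>m n n" using carr[OF zB] by (intro eq_matI) auto
  finally have \<phi>0: "\<phi> 0 = 0\<^sub>m n n" .
  define e :: "nat \<Rightarrow> nat \<Rightarrow> 'f mat" where
    "e a b = mat n n (\<lambda>(i, j). if i = a \<and> j = b then 1 else 0)" for a b
  define F where "F a b = inv_into B \<phi> (e a b)" for a b
  have FB: "F a b \<in> B" and \<phi>F: "\<phi> (F a b) = e a b" for a b
  proof -
    have "e a b \<in> \<phi> ` B" using bij by (auto simp: bij_betw_def e_def)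
    thus "F a b \<in> B" "\<phi> (F a b) = e a b"
      unfolding F_def by (auto intro: inv_into_into f_inv_into_f)
  qed
  have e_mult: "e a b * e c d = (if b = c then e a d else 0\<^sub>m n n)"
    if "a < n" "b < n" "c < n" "d < n" for a b c d
  proof (rule eq_matI, goal_cases)
    case (1 i j)
    hence ij: "i < n" "j < n" by (auto simp: e_def split: if_splits)
    have "(e a b * e c d) $$ (i, j) =
        (\<Sum>k<n. (if i = a \<and> k = b then 1 else 0) * (if k = c \<and> j = d then 1 else 0))"
      using ij by (simp add: e_def scalar_prod_def lessThan_atLeast0)
    also have "\<dots> = (\<Sum>k<n. if k = b then (if i = a \<and> b = c \<and> j = d then 1 else 0) else 0)"
      by (rule sum.cong) auto
    also have "\<dots> = (if i = a \<and> b = c \<and> j = d then 1 else 0)" using that by simp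
    finally show ?case using ij by (simp add: e_def)
  qed (auto simp: e_def)
  have units: "matrix_units n F"
    unfolding matrix_units_def
  proof (intro conjI allI impI)
    fix a b c d assume "a < n" "b < n" "c < n" "d < n"
    thus "F a b * F c d = (if b = c then F a d else 0)"
      by (intro inj) (auto simp: mB FB zB mul \<phi>F \<phi>0 e_mult)
  next
    fix a assume "a < n"
    hence "e a a $$ (a, a) \<noteq> (0\<^sub>m n n :: 'f mat) $$ (a, a)" by (simp add: e_def)
    thus "F a a \<noteq> 0" using \<phi>F \<phi>0 by metis
  qed
  have sum_entry: "(\<Sum>t\<in>T. g t) \<in> B \<and>
      (\<forall>i<n. \<forall>j<n. \<phi> (\<Sum>t\<in>T. g t) $$ (i, j) = (\<Sum>t\<in>T. \<phi> (g t) $$ (i, j)))"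
    if "finite T" "\<And>t. g t \<in> B" for T :: "(nat \<times> nat) set" and g
    using that
  proof (induction T rule: finite_induct)
    case empty
    thus ?case by (simp add: zB \<phi>0)
  next
    case (insert t T)
    have T: "sum g T \<in> B" "g t \<in> B" using insert by auto
    thus ?case using insert carr[OF T(1)] carr[OF T(2)]
      by (auto simp: add subspace_add[OF sub])
  qed
  have "B = span ((\<lambda>(a, b). F a b) ` ({..<n} \<times> {..<n}))" (is "B = span ?F")
  proof
    show "span ?F \<subseteq> B" by (rule span_minimal[OF _ sub]) (auto simp: FB)
    show "B \<subseteq> span ?F"
    proof
      fix x assume x: "x \<in> B"
      let ?g = "\<lambda>t. \<phi> x $$ t *s (case t of (a, b) \<Rightarrow> F a b)"
      let ?y = "\<Sum>t\<in>{..<n} \<times> {..<n}. ?g t"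
      have gB: "?g t \<in> B" for t by (auto split: prod.split intro: subspace_scale[OF sub] FB)
      have fin: "finite ({..<n} \<times> {..<n})" by simp
      have yB: "?y \<in> B"
        and y: "\<And>i j. i < n \<Longrightarrow> j < n \<Longrightarrow> \<phi> ?y $$ (i, j) = (\<Sum>t\<in>{..<n} \<times> {..<n}. \<phi> (?g t) $$ (i, j))"
        using sum_entry[OF fin, of ?g, OF gB] by blast+
      have "\<phi> ?y = \<phi> x"
      proof (rule eq_matI)
        fix i j assume "i < dim_row (\<phi> x)" "j < dim_col (\<phi> x)"
        hence ij: "i < n" "j < n" using carr[OF x] by auto
        have "\<phi> ?y $$ (i, j) = (\<Sum>t\<in>{..<n} \<times> {..<n}. if t = (i, j) then \<phi> x $$ t else 0)"
          unfolding y[OF ij] using ij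
          by (intro sum.cong) (auto simp: scl FB \<phi>F, auto simp: e_def split: if_splits)
        thus "\<phi> ?y $$ (i, j) = \<phi> x $$ (i, j)" using ij by (simp add: sum.delta)
      qed (use carr[OF x] carr[OF yB] in auto)
      hence "x = ?y" using inj[OF x yB] by simp
      moreover have "?y \<in> span ?F"
        by (rule span_sum, rule span_scale, rule span_base) auto
      ultimately show "x \<in> span ?F" by simp
    qed
  qed
  thus thesis using units that by blast
qed

lemma independent_matrix_unit_column:
  assumes u: "matrix_units n u" and n: "0 < n"
  shows "independent ((\<lambda>s. u s 0) ` {..<n})" "card ((\<lambda>s. u s 0) ` {..<n}) = n"
proof -
  have nz: "u 0 0 \<noteq> 0" using u n by (rule matrix_units_nonzero)
  have pick: "u 0 s * u t 0 = (if s = t then u 0 0 else 0)" if "s < n" "t < n" for s t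
    using matrix_units_mult[OF u n that n] .
  have inj: "inj_on (\<lambda>s. u s 0) {..<n}"
  proof (rule inj_onI)
    fix s t assume st: "s \<in> {..<n}" "t \<in> {..<n}" "u s 0 = u t 0"
    show "s = t" using pick[of s s] pick[of s t] st nz by (auto split: if_splits)
  qed
  thus "card ((\<lambda>s. u s 0) ` {..<n}) = n" by (simp add: card_image)
  show "independent ((\<lambda>s. u s 0) ` {..<n})"
  proof (rule independent_if_scalars_zero)
    fix f x assume sum: "(\<Sum>x\<in>(\<lambda>s. u s 0) ` {..<n}. f x *s x) = 0"
      and "x \<in> (\<lambda>s. u s 0) ` {..<n}"
    then obtain t where t: "t < n" "x = u t 0" by auto
    have "0 = u 0 t * (\<Sum>s<n. f (u s 0) *s u s 0)"
      using sum by (simp add: sum.reindex[OF inj])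
    also have "\<dots> = (\<Sum>s<n. if s = t then f (u s 0) *s u 0 0 else 0)"
      unfolding sum_distrib_left
      by (rule sum.cong) (auto simp: scale_mult_right pick t)
    also have "\<dots> = f x *s u 0 0" using t by simp
    finally show "f x = 0" using nz by simp
  qed simp
qed

text \<open>A pigeonhole principle for dimensions, to be applied to a decomposition of the identity into
  idempotents: bases of the images \<open>span (G p ` C)\<close> together span \<open>C\<close>, so they cannot all be small.\<close>

lemma independent_subset_of_summand:
  assumes C: "independent C" and big: "m * k < card C"
    and decomp: "\<And>x. x \<in> C \<Longrightarrow> x = (\<Sum>p<m. G p x)"
  obtains p V where "p < m" "V \<subseteq> G p ` C" "independent V" "card V = Suc k"
proof -
  have finC: "finite C" using big card.infinite by force
  have "\<exists>B. B \<subseteq> G p ` C \<and> independent B \<and> G p ` C \<subseteq> span B" for p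
    using maximal_independent_subset[of "G p ` C"] by metis
  then obtain B where B: "\<And>p. B p \<subseteq> G p ` C" "\<And>p. independent (B p)"
    "\<And>p. G p ` C \<subseteq> span (B p)" by metis
  have finB: "finite (B p)" for p using B(1) finC by (meson finite_imageI finite_subset)
  have "\<exists>p<m. k < card (B p)"
  proof (rule ccontr)
    assume "\<not> ?thesis"
    hence small: "card (B p) \<le> k" if "p < m" for p using that by force
    have "C \<subseteq> span (\<Union>p<m. B p)"
    proof
      fix x assume x: "x \<in> C"
      have "(\<Sum>p<m. G p x) \<in> span (\<Union>p<m. B p)"
      proof (rule span_sum)
        fix p assume "p \<in> {..<m}"
        hence "span (B p) \<subseteq> span (\<Union>p<m. B p)" by (intro span_mono) auto
        thus "G p x \<in> span (\<Union>p<m. B p)" using B(3)[of p] x by auto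
      qed
      thus "x \<in> span (\<Union>p<m. B p)" using decomp[OF x] by simp
    qed
    hence "card C \<le> card (\<Union>p<m. B p)"
      using independent_span_bound[OF _ C] finB by simp
    also have "\<dots> \<le> (\<Sum>p<m. card (B p))" by (rule card_UN_le) simp
    also have "\<dots> \<le> m * k" using sum_mono[of "{..<m}" "\<lambda>p. card (B p)" "\<lambda>_. k"] small by simp
    finally show False using big by simp
  qed
  then obtain p where p: "p < m" "Suc k \<le> card (B p)" by auto
  obtain V where V: "V \<subseteq> B p" "card V = Suc k" using obtain_subset_with_card_n[OF p(2)] by metis
  show thesis using that[OF p(1), of V] V B independent_mono by (metis subset_trans)
qed

text \<open>Every linear functional on the column space \<open>span {u s 0 | s. s < n}\<close> is left multiplication by
  an element of the first row when scalars are identified with multiples of \<open>u 0 0\<close>. The elements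
  \<open>w x\<close> represent the functionals dual to \<open>V\<close>; the products \<open>x * w y\<close> will be matrix units.\<close>

lemma dual_family:
  assumes u: "matrix_units n u" and n: "0 < n"
    and V: "independent V" "V \<subseteq> span ((\<lambda>s. u s 0) ` {..<n})"
  obtains w where "\<And>x y. x \<in> V \<Longrightarrow> y \<in> V \<Longrightarrow> w x * y = (if x = y then u 0 0 else 0)"
proof -
  interpret vector_space_pair scale scale by unfold_locales
  have "\<exists>f. Vector_Spaces.linear scale scale f \<and> (\<forall>y\<in>V. f y = (if x = y then u 0 0 else 0)) \<and>
      range f = span ((\<lambda>y. if x = y then u 0 0 else 0) ` V)" for x
    by (rule linear_independent_extend_subspace[OF V(1)])
  then obtain f where f: "\<And>x. Vector_Spaces.linear scale scale (f x)"
      "\<And>x y. y \<in> V \<Longrightarrow> f x y = (if x = y then u 0 0 else 0)"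
      "\<And>x. range (f x) = span ((\<lambda>y. if x = y then u 0 0 else 0) ` V)" by metis
  have absorb: "f x z * u 0 0 = f x z" for x z
  proof -
    have "f x z \<in> span ((\<lambda>y. if x = y then u 0 0 else 0) ` V)" using f(3) by blast
    moreover have "subspace {z. z * u 0 0 = z}"
      by (auto simp: subspace_def distrib_right scale_mult_left)
    hence "span ((\<lambda>y. if x = y then u 0 0 else 0) ` V) \<subseteq> {z. z * u 0 0 = z}"
      by (rule span_minimal[rotated]) (auto simp: matrix_units_mult[OF u n n n n])
    ultimately show ?thesis by blast
  qed
  \<comment> \<open>The row whose entries are the values of the functional on the basis of the column space.\<close>
  define w where "w x = (\<Sum>t<n. f x (u t 0) * u 0 t)" for x
  have w: "w x * z = f x z" if "z \<in> span ((\<lambda>s. u s 0) ` {..<n})" for x z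
  proof -
    have "subspace {z. w x * z = f x z}"
      using f(1)[of x] linear_0[OF f(1), of x] unfolding Vector_Spaces.linear_iff
      by (auto simp: subspace_def distrib_left scale_mult_right)
    moreover have "w x * u s 0 = f x (u s 0)" if s: "s < n" for s
    proof -
      have "w x * u s 0 = (\<Sum>t<n. if t = s then f x (u t 0) * u 0 0 else 0)"
        unfolding w_def sum_distrib_right
        by (rule sum.cong) (use matrix_units_mult[OF u n _ s n] in \<open>auto simp: mult.assoc\<close>)
      thus ?thesis using s absorb by simp
    qed
    ultimately have "span ((\<lambda>s. u s 0) ` {..<n}) \<subseteq> {z. w x * z = f x z}"
      by (intro span_minimal) auto
    thus ?thesis using that by blast
  qed
  show thesis by (rule that[of w]) (use V(2) w f(2) in auto)
qed

end

section \<open>Large matrix units in centralizers\<close>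

context locally_matrix_algebra
begin

lemma matrix_units_containing:
  fixes S :: "'b set"
  assumes "finite S"
  obtains n and F :: "nat \<Rightarrow> nat \<Rightarrow> 'b" where "0 < n" "matrix_units n F"
    "S \<subseteq> span ((\<lambda>(a, b). F a b) ` ({..<n} \<times> {..<n}))"
  using locally_matrix[OF assms] matrix_iso_matrix_units by (metis One_nat_def Suc_le_eq)

text \<open>For \<open>J\<close> infinite and independent, large matrix subalgebras exist, and the centralizer of \<open>S\<close>
  inherits their size: an idempotent of large rank among \<open>F p p\<close> and \<open>1 - E\<close> gives independent vectors
  \<open>v\<close> in its image and dual rows \<open>w'\<close>, hence matrix units \<open>v q * w' r\<close> in its corner.\<close>

lemma matrix_units_commuting:
  fixes J S :: "'b set"
  assumes inf: "infinite J" "independent J" and S: "finite S"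
  obtains U :: "nat \<Rightarrow> nat \<Rightarrow> 'b" where "matrix_units (Suc k) U"
    "\<And>p q x. p \<le> k \<Longrightarrow> q \<le> k \<Longrightarrow> x \<in> S \<Longrightarrow> U p q * x = x * U p q"
proof -
  obtain n F where n: "0 < n" and F: "matrix_units n F"
    and SF: "S \<subseteq> span ((\<lambda>(a, b). F a b) ` ({..<n} \<times> {..<n}))" (is "_ \<subseteq> span ?F")
    using matrix_units_containing[OF S] .
  \<comment> \<open>If the larger algebra has matrix size \<open>N > L\<close>, one of \<open>Suc n\<close> idempotents with sum \<open>1\<close> has rank
    more than \<open>k\<close>; having dimension at most \<open>N * N\<close>, it satisfies this as soon as it contains more
    than \<open>L * L\<close> independent elements.\<close>
  define L where "L = Suc n * k"
  obtain X where X: "X \<subseteq> J" "finite X" "card X = Suc (L * L)"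
    using infinite_arbitrarily_large[OF inf(1)] by metis
  obtain N u where N: "0 < N" and u: "matrix_units N u"
    and Xu: "X \<union> ?F \<subseteq> span ((\<lambda>(a, b). u a b) ` ({..<N} \<times> {..<N}))" (is "_ \<subseteq> span ?u")
    using matrix_units_containing[of "X \<union> ?F"] X(2) by auto
  have "independent X" using X(1) inf(2) independent_mono by blast
  hence "card X \<le> card ?u" using independent_span_bound[of ?u X] Xu by auto
  also have "\<dots> \<le> N * N" using card_image_le[of "{..<N} \<times> {..<N}" "\<lambda>(a, b). u a b"] by simp
  finally have "L < N" using X(3) by (metis Suc_le_lessD leI mult_le_mono not_le)
  define C where "C = (\<lambda>s. u s 0) ` {..<N}"
  have C: "independent C" "card C = N"
    unfolding C_def using independent_matrix_unit_column[OF u N] by auto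
  define E where "E = (\<Sum>a<n. F a a)"
  have EF: "E * F a b = F a b" and FE: "F a b * E = F a b" if "a < n" "b < n" for a b
  proof -
    have "E * F a b = (\<Sum>c<n. if c = a then F a b else 0)"
      unfolding E_def sum_distrib_right
      by (rule sum.cong) (auto simp: matrix_units_mult[OF F] that)
    thus "E * F a b = F a b" using that by simp
    have "F a b * E = (\<Sum>c<n. if c = b then F a b else 0)"
      unfolding E_def sum_distrib_left
      by (rule sum.cong) (auto simp: matrix_units_mult[OF F] that)
    thus "F a b * E = F a b" using that by simp
  qed
  have EE: "E * E = E"
    unfolding E_def sum_distrib_left by (rule sum.cong) (simp_all flip: E_def add: EF)
  \<comment> \<open>\<open>G n\<close> is left multiplication by \<open>1 - E\<close>, written so as to make sense without a unit.\<close>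
  define G where "G p x = (if p < n then F p p * x else x - E * x)" for p x
  have decomp: "x = (\<Sum>p<Suc n. G p x)" for x
    by (simp add: G_def E_def sum_distrib_right)
  obtain p V where p: "p < Suc n" and V: "V \<subseteq> G p ` C" "independent V" "card V = Suc k"
    using independent_subset_of_summand[OF C(1), of "Suc n" k G] decomp \<open>L < N\<close> C(2)
    unfolding L_def by metis
  have left: "y * x \<in> span C" if y: "y \<in> span ?u" and x: "x \<in> C" for x y
  proof -
    obtain s where s: "s < N" "x = u s 0" using x C_def by auto
    have "subspace {y. y * x \<in> span C}"
      by (auto simp: subspace_def distrib_right scale_mult_left span_zero span_add span_scale)
    moreover have "u a b * x \<in> span C" if "a < N" "b < N" for a b
      using matrix_units_mult[OF u that s(1) N] s that
      by (auto simp: C_def span_zero intro: span_base)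
    ultimately have "span ?u \<subseteq> {y. y * x \<in> span C}" by (intro span_minimal) auto
    thus ?thesis using y by blast
  qed
  have Fu: "F a b \<in> span ?u" if "a < n" "b < n" for a b using Xu that by auto
  have Eu: "E \<in> span ?u" unfolding E_def by (rule span_sum) (simp add: Fu)
  have "G p x \<in> span C" if "x \<in> C" for x
    using left[OF Fu that, of p p] span_diff[OF span_base[OF that] left[OF Eu that]]
    by (simp add: G_def)
  hence VC: "V \<subseteq> span ((\<lambda>s. u s 0) ` {..<N})" using V(1) unfolding C_def by auto
  obtain w where w: "\<And>x y. x \<in> V \<Longrightarrow> y \<in> V \<Longrightarrow> w x * y = (if x = y then u 0 0 else 0)"
    using dual_family[OF u N V(2) VC] by blast
  have "finite V" using V(3) card.infinite by force
  then obtain v where v: "bij_betw v {..<Suc k} V"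
    using ex_bij_betw_nat_finite[of V] V(3) by (auto simp: lessThan_atLeast0)
  have vV: "v r \<in> V" if "r \<le> k" for r using v that by (auto simp: bij_betw_def)
  have veq: "v q = v r \<longleftrightarrow> q = r" if "q \<le> k" "r \<le> k" for q r
    using v that by (auto simp: bij_betw_def inj_on_def)
  have vu: "v r * u 0 0 = v r" if "r \<le> k" for r
  proof -
    have "subspace {z. z * u 0 0 = z}"
      by (auto simp: subspace_def distrib_right scale_mult_left)
    hence "span ((\<lambda>s. u s 0) ` {..<N}) \<subseteq> {z. z * u 0 0 = z}"
      by (rule span_minimal[rotated]) (use matrix_units_mult[OF u _ N N N] in auto)
    thus ?thesis using VC vV[OF that] by blast
  qed
  have unz: "u 0 0 \<noteq> 0" using u N by (rule matrix_units_nonzero)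
  show thesis
  proof (cases "p < n")
    case True
    have Fv: "F p p * v r = v r" if "r \<le> k" for r
      using vV[OF that] V(1) True by (auto simp: G_def matrix_units_mult'[OF F])
    \<comment> \<open>Cutting down to the corner of \<open>F p p\<close> keeps the duality since \<open>F p p\<close> fixes the vectors \<open>v r\<close>.\<close>
    define w' where "w' r = w (v r) * F p p" for r
    have w'v: "w' q * v r = (if q = r then u 0 0 else 0)" if "q \<le> k" "r \<le> k" for q r
      using w[of "v q" "v r"] vV that veq Fv by (simp add: w'_def mult.assoc)
    have w'F: "w' q * F p p = w' q" for q
      using True by (simp add: w'_def mult.assoc matrix_units_mult[OF F])
    \<comment> \<open>The diagonal copy of the corner element \<open>v q * w' r\<close> in the centralizer of \<open>F\<close>.\<close>
    define U where "U q r = (\<Sum>a<n. F a p * v q * w' r * F p a)" for q r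
    have leftF: "F b c * U q r = F b p * v q * w' r * F p c" if "b < n" "c < n" for b c q r
    proof -
      have "F b c * U q r = (\<Sum>a<n. if a = c then F b p * v q * w' r * F p a else 0)"
        unfolding U_def sum_distrib_left
        by (rule sum.cong) (auto simp: mult.assoc matrix_units_mult'[OF F] that True)
      thus ?thesis using that by simp
    qed
    have rightF: "U q r * F b c = F b p * v q * w' r * F p c" if "b < n" "c < n" for b c q r
    proof -
      have "U q r * F b c = (\<Sum>a<n. if a = b then F a p * v q * w' r * F p c else 0)"
        unfolding U_def sum_distrib_right
        by (rule sum.cong) (auto simp: mult.assoc matrix_units_mult[OF F] that True)
      thus ?thesis using that by simp
    qed
    \<comment> \<open>Sandwiching recovers the matrix entries of \<open>U q r\<close>, which shows that it is nonzero.\<close>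
    have wUv: "w' s * U q r * v t = (if s = q then if r = t then u 0 0 else 0 else 0)"
      if "q \<le> k" "r \<le> k" "s \<le> k" "t \<le> k" for q r s t
    proof -
      have "w' s * U q r * v t = w' s * (F p p * U q r) * v t"
        using w'F by (simp add: mult.assoc[symmetric])
      also have "\<dots> = (w' s * F p p) * v q * (w' r * (F p p * v t))"
        using True by (simp add: leftF mult.assoc)
      also have "\<dots> = (w' s * v q) * (w' r * v t)" using that by (simp add: w'F Fv)
      finally show ?thesis using that w'v matrix_units_mult[OF u N N N N] by auto
    qed
    have vu': "x * v q * u 0 0 = x * v q" if "q \<le> k" for x q
      using vu[OF that] by (simp add: mult.assoc)
    have mult: "U q r * U s t = (if r = s then U q t else 0)"
      if qrst: "q \<le> k" "r \<le> k" "s \<le> k" "t \<le> k" for q r s t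
    proof -
      have "U q r * U s t = (\<Sum>a<n. (U q r * F a p) * v s * w' t * F p a)"
        by (subst U_def[of s t]) (simp add: sum_distrib_left mult.assoc)
      also have "\<dots> = (\<Sum>a<n. F a p * v q * (w' r * F p p * v s) * w' t * F p a)"
        using True by (intro sum.cong) (simp_all add: rightF mult.assoc)
      also have "\<dots> = (if r = s then U q t else 0)"
        using qrst by (simp add: w'F w'v U_def vu')
      finally show ?thesis .
    qed
    have "matrix_units (Suc k) U"
      unfolding matrix_units_def
    proof (intro conjI allI impI)
      fix q assume "q < Suc k"
      thus "U q q \<noteq> 0" using wUv[of q q q q] unz by auto
    qed (use mult in auto)
    moreover have "U q r * x = x * U q r" if "x \<in> S" for x q r
    proof -
      have "subspace {x. U q r * x = x * U q r}"
        by (auto simp: subspace_def distrib_right distrib_left scale_mult_left scale_mult_right)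
      hence "span ?F \<subseteq> {x. U q r * x = x * U q r}"
        by (rule span_minimal[rotated]) (auto simp: leftF rightF)
      thus ?thesis using that SF by blast
    qed
    ultimately show thesis using that by blast
  next
    case False
    have Ev: "E * v r = 0" if "r \<le> k" for r
      using vV[OF that] V(1) False EE
      by (auto simp: G_def right_diff_distrib mult.assoc[symmetric])
    define w' where "w' r = w (v r) - w (v r) * E" for r
    have w'v: "w' q * v r = (if q = r then u 0 0 else 0)" if "q \<le> k" "r \<le> k" for q r
      using w[of "v q" "v r"] vV that veq Ev by (simp add: w'_def left_diff_distrib mult.assoc)
    have w'E: "w' q * E = 0" for q
      by (simp add: w'_def left_diff_distrib mult.assoc EE)
    define U where "U q r = v q * w' r" for q r
    have mult: "U q r * U s t = (if r = s then U q t else 0)"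
      if qrst: "q \<le> k" "r \<le> k" "s \<le> k" "t \<le> k" for q r s t
    proof -
      have "U q r * U s t = v q * (w' r * v s) * w' t" by (simp add: U_def mult.assoc)
      thus ?thesis using qrst by (simp add: w'v U_def vu)
    qed
    have "matrix_units (Suc k) U"
      unfolding matrix_units_def
    proof (intro conjI allI impI)
      fix q assume "q < Suc k"
      hence q: "q \<le> k" by simp
      have "w' q * U q q * v q = (w' q * v q) * (w' q * v q)" by (simp add: U_def mult.assoc)
      also have "\<dots> = u 0 0" using q w'v matrix_units_mult[OF u N N N N] by simp
      finally show "U q q \<noteq> 0" using unz by auto
    qed (use mult in auto)
    moreover have "U q r * x = x * U q r" if "x \<in> S" "q \<le> k" for x q r
    proof -
      have sub: "subspace {x. U q r * x = x * U q r}"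
        by (auto simp: subspace_def distrib_right distrib_left scale_mult_left scale_mult_right)
      have "U q r * F a b = F a b * U q r" if ab: "a < n" "b < n" for a b
      proof -
        have "U q r * F a b = v q * (w' r * E) * F a b"
          unfolding U_def mult.assoc using EF[OF ab] by simp
        moreover have "F a b * U q r = F a b * (E * v q) * w' r"
          unfolding U_def mult.assoc[symmetric] using FE[OF ab] by simp
        ultimately show ?thesis using w'E Ev \<open>q \<le> k\<close> by simp
      qed
      hence "span ?F \<subseteq> {x. U q r * x = x * U q r}" by (intro span_minimal[OF _ sub]) auto
      thus ?thesis using that SF by blast
    qed
    ultimately show thesis using that by blast
  qed
qed

end

section \<open>Infinite sums of inner derivations\<close>

definition commutator :: "'a::ring \<Rightarrow> 'a \<Rightarrow> 'a" where
  "commutator x y = x * y - y * x"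

lemma commutator_zero [simp]: "commutator x 0 = 0" "commutator 0 x = 0"
  by (simp_all add: commutator_def)

lemma commutator_add: "commutator x (y + z) = commutator x y + commutator x z"
  by (simp add: commutator_def algebra_simps)

lemma commutator_mult: "commutator x (y * z) = commutator x y * z + y * commutator x z"
  by (simp add: commutator_def algebra_simps)

lemma commutator_sum: "commutator x (sum f I) = (\<Sum>i\<in>I. commutator x (f i))"
  by (simp add: commutator_def sum_distrib_left sum_distrib_right sum_subtractf)

lemma commutator_sum_left: "commutator (sum f I) x = (\<Sum>i\<in>I. commutator (f i) x)"
  by (simp add: commutator_def sum_distrib_left sum_distrib_right sum_subtractf)

lemma commutator_eq_0_sym: "commutator x y = 0 \<Longrightarrow> commutator y x = 0"
  by (simp add: commutator_def)

lemma commutator_jacobi: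
  "commutator (commutator x y) z = commutator x (commutator y z) - commutator y (commutator x z)"
  by (simp add: commutator_def algebra_simps)

definition locally_finite_family :: "(nat \<Rightarrow> 'a::ring) \<Rightarrow> bool" where
  "locally_finite_family c \<longleftrightarrow> (\<forall>x. finite {i. commutator (c i) x \<noteq> 0})"

text \<open>The sum runs over the indices that contribute, so that for a locally finite family it is the
  pointwise value of the infinite sum \<open>\<Sum>i. ad (c i)\<close>.\<close>

definition sum_ad :: "(nat \<Rightarrow> 'a::ring) \<Rightarrow> 'a \<Rightarrow> 'a" where
  "sum_ad c x = (\<Sum>i | commutator (c i) x \<noteq> 0. commutator (c i) x)"

lemma sum_ad_eq:
  assumes "finite I" "\<And>i. i \<notin> I \<Longrightarrow> commutator (c i) x = 0"
  shows "sum_ad c x = (\<Sum>i\<in>I. commutator (c i) x)"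
  unfolding sum_ad_def by (rule sum.mono_neutral_left) (use assms in auto)

lemma locally_finite_commutator:
  assumes c: "locally_finite_family c" and d: "locally_finite_family d"
  shows "locally_finite_family (\<lambda>i. commutator (c i) (d i))"
  unfolding locally_finite_family_def
proof
  fix x
  let ?I = "{i. commutator (c i) x \<noteq> 0} \<union> {i. commutator (d i) x \<noteq> 0}"
  have "{i. commutator (commutator (c i) (d i)) x \<noteq> 0} \<subseteq> ?I"
    by (auto simp: commutator_jacobi)
  moreover have "finite ?I" using c d by (simp add: locally_finite_family_def)
  ultimately show "finite {i. commutator (commutator (c i) (d i)) x \<noteq> 0}"
    by (rule finite_subset)
qed

text \<open>By the Jacobi identity the bracket is \<open>\<Sum>i j. ad [c i, d j]\<close>, in which only the diagonal terms
  survive. The work is to replace both infinite sums by sums over one finite index set.\<close>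

lemma bracket_sum_ad:
  assumes c: "locally_finite_family c" and d: "locally_finite_family d"
    and cd: "\<And>i j. i \<noteq> j \<Longrightarrow> commutator (c i) (d j) = 0"
  shows "sum_ad c (sum_ad d x) - sum_ad d (sum_ad c x) = sum_ad (\<lambda>i. commutator (c i) (d i)) x"
proof -
  define supp where "supp f y = {i. commutator (f i) y \<noteq> 0}" for f :: "nat \<Rightarrow> 'a" and y
  have fin: "finite (supp c y)" "finite (supp d y)" for y
    using c d by (auto simp: locally_finite_family_def supp_def)
  define I where "I = supp c x \<union> supp d x"
  \<comment> \<open>Outside \<open>J\<close> neither \<open>c\<close> nor \<open>d\<close> acts on \<open>x\<close> or on any of the elements \<open>[d i, x]\<close>, \<open>[c i, x]\<close>;
    for \<open>i\<close> outside \<open>I\<close> these elements vanish, so that finitely many \<open>i\<close> suffice.\<close>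
  define J where "J = I \<union> (\<Union>i\<in>I. supp c (commutator (d i) x)) \<union> (\<Union>i\<in>I. supp d (commutator (c i) x))"
  have J: "finite J" by (simp add: J_def I_def fin)
  have x0: "commutator (c i) x = 0" "commutator (d i) x = 0" if "i \<notin> I" for i
    using that by (auto simp: I_def supp_def)
  have IJ: "I \<subseteq> J" by (auto simp: J_def)
  have cd0: "commutator (c j) (commutator (d i) x) = 0"
    and dc0: "commutator (d j) (commutator (c i) x) = 0" if "j \<notin> J" for i j
    using that x0[of i] by (cases "i \<in> I"; auto simp: J_def supp_def)+
  have "sum_ad d x = (\<Sum>i\<in>J. commutator (d i) x)" "sum_ad c x = (\<Sum>i\<in>J. commutator (c i) x)"
    using x0 IJ by (auto intro!: sum_ad_eq J)
  hence "sum_ad c (sum_ad d x) = (\<Sum>j\<in>J. \<Sum>i\<in>J. commutator (c j) (commutator (d i) x))"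
    and "sum_ad d (sum_ad c x) = (\<Sum>i\<in>J. \<Sum>j\<in>J. commutator (d i) (commutator (c j) x))"
    by (simp_all add: sum_ad_eq[OF J] commutator_sum cd0 dc0)
  hence "sum_ad c (sum_ad d x) - sum_ad d (sum_ad c x) =
      (\<Sum>j\<in>J. \<Sum>i\<in>J. commutator (commutator (c j) (d i)) x)"
    by (subst (asm) (2) sum.swap) (simp add: commutator_jacobi sum_subtractf)
  also have "\<dots> = (\<Sum>j\<in>J. \<Sum>i\<in>J. if i = j then commutator (commutator (c j) (d j)) x else 0)"
    by (intro sum.cong refl) (simp add: cd)
  also have "\<dots> = (\<Sum>j\<in>J. commutator (commutator (c j) (d j)) x)" using J by simp
  also have "\<dots> = sum_ad (\<lambda>i. commutator (c i) (d i)) x"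
    by (rule sum_ad_eq[symmetric, OF J]) (simp add: commutator_jacobi cd0 dc0)
  finally show ?thesis .
qed

context assoc_algebra
begin

lemma commutator_scale_left: "commutator (r *s x) y = r *s commutator x y"
  by (simp add: commutator_def scale_mult_left scale_mult_right scale_right_diff_distrib)

lemma commutator_scale: "commutator x (r *s y) = r *s commutator x y"
  by (simp add: commutator_def scale_mult_left scale_mult_right scale_right_diff_distrib)

lemma derivation_sum_ad:
  assumes c: "locally_finite_family c"
  shows "derivation (sum_ad c)"
  unfolding derivation_iff
proof (intro conjI allI)
  fix x y r
  define I where "I = {i. commutator (c i) x \<noteq> 0} \<union> {i. commutator (c i) y \<noteq> 0}"
  have I: "finite I" using c by (simp add: locally_finite_family_def I_def)
  have "commutator (c i) x = 0" "commutator (c i) y = 0" if "i \<notin> I" for i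
    using that by (auto simp: I_def)
  note eq = sum_ad_eq[OF I, of c] this
  show "sum_ad c (x + y) = sum_ad c x + sum_ad c y"
    by (simp add: eq commutator_add sum.distrib)
  show "sum_ad c (r *s x) = r *s sum_ad c x"
    by (simp add: eq commutator_scale scale_sum_right)
  show "sum_ad c (x * y) = sum_ad c x * y + x * sum_ad c y"
    by (simp add: eq commutator_mult sum.distrib sum_distrib_left sum_distrib_right)
qed

end

section \<open>The shift and a corner matrix unit\<close>

definition shift :: "nat \<Rightarrow> (nat \<Rightarrow> nat \<Rightarrow> 'a::ring) \<Rightarrow> 'a" where
  "shift k U = (\<Sum>j<k. U (Suc j) j)"

text \<open>The elements \<open>ad (shift k U) ^ m\<close> applied to the unit in the top right corner.\<close>

definition iterated :: "nat \<Rightarrow> (nat \<Rightarrow> nat \<Rightarrow> 'a::ring) \<Rightarrow> nat \<Rightarrow> 'a" where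
  "iterated k U m = (commutator (shift k U) ^^ m) (U 0 k)"

lemma iterated_simps [simp]:
  "iterated k U 0 = U 0 k"
  "iterated k U (Suc m) = commutator (shift k U) (iterated k U m)"
  by (simp_all add: iterated_def)

text \<open>The shift annihilates the last diagonal unit from the left. Hence in \<open>[shift, y] * U k k\<close> only the
  term \<open>shift * (y * U k k)\<close> remains, and iterating the commutator moves the last column one step down.\<close>

lemma iterated_mult_last:
  assumes U: "matrix_units (Suc k) U" and m: "m \<le> k"
  shows "iterated k U m * U k k = U m k"
  using m
proof (induction m)
  case 0
  show ?case using matrix_units_mult[OF U, of 0 k k k] by simp
next
  case (Suc m)
  have "shift k U * U m k = (\<Sum>j<k. if j = m then U (Suc m) k else 0)"
    unfolding shift_def sum_distrib_right
    by (rule sum.cong) (use Suc in \<open>auto simp: matrix_units_mult[OF U]\<close>)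
  hence up: "shift k U * U m k = U (Suc m) k" using Suc by simp
  have last: "shift k U * U k k = 0"
    unfolding shift_def sum_distrib_right by (simp add: matrix_units_mult[OF U])
  have "iterated k U (Suc m) * U k k =
      shift k U * (iterated k U m * U k k) - iterated k U m * (shift k U * U k k)"
    by (simp add: commutator_def left_diff_distrib mult.assoc)
  thus ?case using Suc up last by simp
qed

context assoc_algebra
begin

text \<open>The product of the combination \<open>s\<close> with \<open>h = U k k\<close> is \<open>\<Sum>m\<le>r. d m *s U m k\<close>. If \<open>s\<close> commutes with
  \<open>h\<close>, then \<open>s * h = h * s * h\<close>, whereas \<open>h * U m k = 0\<close> for \<open>m < k\<close>; so \<open>s * h = 0\<close>, and the coefficients
  can be read off. The condition \<open>r < k\<close> keeps \<open>U k k\<close> itself out of the sum.\<close>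

lemma iterated_independent:
  assumes U: "matrix_units (Suc k) U" and r: "r < k"
    and comm: "commutator (\<Sum>m\<le>r. d m *s iterated k U m) (U k k) = 0" (is "commutator ?s _ = 0")
    and l: "l \<le> r"
  shows "d l = 0"
proof -
  have sh: "?s * U k k = (\<Sum>m\<le>r. d m *s U m k)"
    unfolding sum_distrib_right
    by (rule sum.cong) (use r in \<open>auto simp: scale_mult_left iterated_mult_last[OF U]\<close>)
  have "?s * U k k = U k k * ?s * U k k"
    using comm matrix_units_mult[OF U, of k k k k]
    by (simp add: commutator_def) (metis mult.assoc)
  also have "\<dots> = (\<Sum>m\<le>r. U k k * d m *s U m k)"
    by (subst mult.assoc) (simp only: sh sum_distrib_left)
  also have "\<dots> = 0"
    by (rule sum.neutral) (use r in \<open>auto simp: scale_mult_right matrix_units_mult[OF U]\<close>)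
  finally have "0 = U k l * (\<Sum>m\<le>r. d m *s U m k)" using sh by simp
  also have "\<dots> = (\<Sum>m\<le>r. if m = l then d l *s U k k else 0)"
    unfolding sum_distrib_left
    by (rule sum.cong) (use r l in \<open>auto simp: scale_mult_right matrix_units_mult[OF U]\<close>)
  finally have "d l *s U k k = 0" using l by simp
  thus ?thesis using matrix_units_nonzero[OF U, of k] by simp
qed

end

section \<open>Pairwise commuting systems of matrix units\<close>

context locally_matrix_algebra
begin

text \<open>The elements commuting with almost all systems form a subspace, so it suffices that every member
  of a countable basis is among them.\<close>

lemma commuting_matrix_units_sequence:
  assumes countable_dimensional
  obtains U :: "nat \<Rightarrow> nat \<Rightarrow> nat \<Rightarrow> 'b" where "\<And>i. matrix_units (Suc i) (U i)"
    "\<And>i j p q r s. i \<noteq> j \<Longrightarrow> p \<le> i \<Longrightarrow> q \<le> i \<Longrightarrow> r \<le> j \<Longrightarrow> s \<le> j \<Longrightarrow>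
       commutator (U i p q) (U j r s) = 0"
    "\<And>x. \<exists>l. \<forall>i\<ge>l. \<forall>p\<le>i. \<forall>q\<le>i. commutator (U i p q) x = 0"
proof -
  obtain J where J: "independent J" "span J = UNIV" "countable J" "infinite J"
    using assms unfolding countable_dimensional_def by blast
  define G where "G S k = (SOME U. matrix_units (Suc k) U \<and>
      (\<forall>p\<le>k. \<forall>q\<le>k. \<forall>x\<in>S. U p q * x = x * U p q))" for S :: "'b set" and k
  have "\<exists>U. matrix_units (Suc k) U \<and> (\<forall>p\<le>k. \<forall>q\<le>k. \<forall>x\<in>S. U p q * x = x * U p q)"
    if "finite S" for S :: "'b set" and k
    by (rule matrix_units_commuting[OF J(4,1) that, of k]) blast
  hence "matrix_units (Suc k) (G S k) \<and> (\<forall>p\<le>k. \<forall>q\<le>k. \<forall>x\<in>S. G S k p q * x = x * G S k p q)"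
    if "finite S" for S k
    unfolding G_def by (rule someI_ex) (rule that)
  hence G: "\<And>S k. finite S \<Longrightarrow> matrix_units (Suc k) (G S k)"
    "\<And>S k p q x. \<lbrakk>finite S; p \<le> k; q \<le> k; x \<in> S\<rbrakk> \<Longrightarrow> G S k p q * x = x * G S k p q"
    by blast+
  \<comment> \<open>\<open>St i\<close> collects everything that the system number \<open>i\<close> has to commute with: the first \<open>i\<close> basis
    elements and all earlier systems.\<close>
  define St where "St = rec_nat {} (\<lambda>i S. insert (from_nat_into J i)
      (S \<union> (\<lambda>(p, q). G S i p q) ` ({..i} \<times> {..i})))"
  have St: "St 0 = {}" "\<And>i. St (Suc i) = insert (from_nat_into J i)
      (St i \<union> (\<lambda>(p, q). G (St i) i p q) ` ({..i} \<times> {..i}))"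
    by (simp_all add: St_def)
  have fin: "finite (St i)" for i by (induction i) (simp_all add: St)
  have mono: "St i \<subseteq> St j" if "i \<le> j" for i j
    using that by (rule lift_Suc_mono_le[rotated]) (auto simp: St)
  define U where "U i = G (St i) i" for i
  have cS: "commutator (U i p q) x = 0" if "p \<le> i" "q \<le> i" "x \<in> St i" for i p q x
    using G(2)[OF fin that] by (simp add: U_def commutator_def)
  have US: "U i p q \<in> St j" if "i < j" "p \<le> i" "q \<le> i" for i j p q
    using mono[of "Suc i" j] that by (force simp: St U_def)
  have JS: "from_nat_into J i \<in> St j" if "i < j" for i j
    using mono[of "Suc i" j] that by (auto simp: St)
  have "commutator (U i p q) (U j r s) = 0"
    if "i \<noteq> j" "p \<le> i" "q \<le> i" "r \<le> j" "s \<le> j" for i j p q r s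
    using that cS US commutator_eq_0_sym by (metis linorder_neqE_nat)
  moreover have "\<exists>l. \<forall>i\<ge>l. \<forall>p\<le>i. \<forall>q\<le>i. commutator (U i p q) x = 0" (is "?P x") for x
  proof -
    have "subspace {x. ?P x}"
      unfolding subspace_def
    proof (safe, goal_cases)
      case (2 x y l l')
      thus ?case by (intro exI[of _ "max l l'"]) (auto simp: commutator_add)
    next
      case (3 r x l)
      thus ?case by (intro exI[of _ l]) (auto simp: commutator_scale)
    qed simp
    moreover have "J \<subseteq> {x. ?P x}"
    proof safe
      fix x assume "x \<in> J"
      then obtain i where "x = from_nat_into J i" using J(3) by (metis from_nat_into_surj)
      thus "?P x" using cS JS by (intro exI[of _ "Suc i"]) (auto simp: less_eq_Suc_le)
    qed
    ultimately have "span J \<subseteq> {x. ?P x}" by (intro span_minimal)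
    thus ?thesis using J(2) by blast
  qed
  ultimately show thesis using G(1)[OF fin] that[of U] by (simp add: U_def)
qed

end

section \<open>Finite-dimensional subspaces of outer derivations\<close>

text \<open>Gaussian elimination: an equation in which \<open>j0\<close> has a nonzero coefficient is solved for that
  unknown and substituted into the others.\<close>

lemma homogeneous_system_nontrivial:
  fixes c :: "'i \<Rightarrow> 'j \<Rightarrow> 'f::field"
  assumes "finite I" "finite J" "card I < card J"
  shows "\<exists>d. (\<exists>j\<in>J. d j \<noteq> 0) \<and> (\<forall>i\<in>I. (\<Sum>j\<in>J. c i j * d j) = 0)"
  using assms
proof (induction I arbitrary: J c rule: finite_induct)
  case empty
  then obtain j where "j \<in> J" by fastforce
  thus ?case by (intro exI[of _ "\<lambda>_. 1"]) auto
next
  case (insert i I)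
  show ?case
  proof (cases "\<forall>j\<in>J. c i j = 0")
    case True
    have "card I < card J" using insert by simp
    then obtain d where "\<exists>j\<in>J. d j \<noteq> 0" "\<forall>i\<in>I. (\<Sum>j\<in>J. c i j * d j) = 0"
      using insert.IH[of J c] insert.prems(1) by blast
    thus ?thesis using True by (intro exI[of _ d]) simp
  next
    case False
    then obtain j0 where j0: "j0 \<in> J" "c i j0 \<noteq> 0" by blast
    let ?J = "J - {j0}"
    have J: "finite ?J" "card I < card ?J" using insert j0 by auto
    obtain d where d: "\<exists>j\<in>?J. d j \<noteq> 0"
      "\<And>k. k \<in> I \<Longrightarrow> (\<Sum>j\<in>?J. (c k j - c k j0 * c i j / c i j0) * d j) = 0"
      using insert.IH[OF J, of "\<lambda>k j. c k j - c k j0 * c i j / c i j0"] by blast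
    let ?e = "- (\<Sum>j\<in>?J. c i j * d j) / c i j0"
    have split: "(\<Sum>j\<in>J. c k j * (d(j0 := ?e)) j) = c k j0 * ?e + (\<Sum>j\<in>?J. c k j * d j)" for k
      using insert.prems(1) j0 by (subst sum.remove[of J j0]) (auto intro!: sum.cong)
    have "(\<Sum>j\<in>J. c k j * (d(j0 := ?e)) j) = 0" if "k \<in> I" for k
    proof -
      have "0 = (\<Sum>j\<in>?J. c k j * d j) - (\<Sum>j\<in>?J. c k j0 / c i j0 * (c i j * d j))"
        using d(2)[OF that] by (simp add: left_diff_distrib sum_subtractf mult.assoc)
      thus ?thesis unfolding split sum_distrib_left[symmetric] by simp
    qed
    moreover have "(\<Sum>j\<in>J. c i j * (d(j0 := ?e)) j) = 0" unfolding split using j0 by simp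
    moreover have "\<exists>j\<in>J. (d(j0 := ?e)) j \<noteq> 0" using d(1) by auto
    ultimately show ?thesis by blast
  qed
qed

context assoc_algebra
begin

abbreviation outer_class :: "('a \<Rightarrow> 'a) \<Rightarrow> ('a \<Rightarrow> 'a) set" where
  "outer_class \<equiv> lie_coset Der Inder"

lemma outer_class_eq_imp:
  assumes "derivation D" "outer_class D = outer_class E"
  shows "\<exists>a. \<forall>x. D x = E x + commutator a x"
proof -
  interpret lie_algebra Der by (rule lie_algebra_Der)
  have "D \<in> outer_class E"
    using coset_self[OF lie_ideal_Inder, of D] assms by (simp add: Der_def)
  thus ?thesis by (auto simp: lie_coset_def Inder_def Der_def commutator_def fun_eq_iff)
qed

text \<open>Linear dependence in the quotient, expressed by representatives. If \<open>K\<close> is spanned by the classes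
  of \<open>r\<close> derivations, then \<open>Y 0\<close>, ..., \<open>Y r\<close> are combinations of these modulo inner derivations, and the
  \<open>r\<close> linear equations in \<open>r + 1\<close> unknowns that express the cancellation of the coefficients have a
  nontrivial solution.\<close>

lemma finite_dimensional_outer_relation:
  assumes K: "lie_finite_dimensional Outder K"
    and Y: "\<And>m. derivation (Y m)" "\<And>m. outer_class (Y m) \<in> K"
  obtains r d a where "\<exists>m\<le>r. d m \<noteq> 0" "\<And>x. (\<Sum>m\<le>(r::nat). d m *s Y m x) = commutator a x"
proof -
  interpret lie_algebra Der by (rule lie_algebra_Der)
  note Q = lie_quotient_simps[OF lie_ideal_Inder, folded Outder_def]
  obtain T where T: "finite T" "T \<subseteq> lcarrier Outder" "K = lie_span Outder T"
    using K unfolding lie_finite_dimensional_def by blast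
  obtain R where R: "R \<subseteq> lcarrier Der" "finite R" "T = outer_class ` R"
    using T(1,2) unfolding Q(1) by (metis finite_subset_image)
  have dR: "derivation t" if "t \<in> R" for t using R(1) that by (auto simp: Der_def)
  define comb where "comb c x = (\<Sum>t\<in>R. c t *s t x)" for c x
  have comb: "comb c \<in> lcarrier Der" for c
  proof -
    have t: "t (x + y) = t x + t y" "t (r *s x) = r *s t x" "t (x * y) = t x * y + x * t y"
      if "t \<in> R" for t x y r
      using dR[OF that] by (auto simp: derivation_iff)
    have "comb c (x + y) = comb c x + comb c y" for x y
      by (simp add: comb_def t(1) scale_right_distrib sum.distrib)
    moreover have "comb c (r *s x) = r *s comb c x" for r x
      by (simp add: comb_def t(2) scale_sum_right mult.commute)
    moreover have "comb c (x * y) = comb c x * y + x * comb c y" for x y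
      by (simp add: comb_def t(3) scale_right_distrib sum.distrib sum_distrib_left
          sum_distrib_right scale_mult_left scale_mult_right)
    ultimately show ?thesis by (simp add: Der_def derivation_iff)
  qed
  define W where "W = range (\<lambda>c. outer_class (comb c))"
  have addc: "ladd Der (comb c) (comb d) = comb (\<lambda>t. c t + d t)"
    and sclc: "lscale Der r (comb c) = comb (\<lambda>t. r * c t)" for c d r
    by (simp_all add: Der_def comb_def fun_eq_iff scale_left_distrib sum.distrib scale_sum_right)
  have zero: "lzero Der = comb (\<lambda>_. 0)" by (simp add: Der_def comb_def fun_eq_iff)
  have "lie_subspace Outder W"
    unfolding lie_subspace_def W_def Q(1,2)
    by (auto simp: comb Q addc sclc zero)
  moreover have "T \<subseteq> W"
  proof
    fix X assume "X \<in> T"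
    then obtain t where t: "t \<in> R" "X = outer_class t" using R(3) by blast
    have "comb (\<lambda>s. if s = t then 1 else 0) x = (\<Sum>s\<in>R. if s = t then t x else 0)" for x
      unfolding comb_def by (rule sum.cong) auto
    hence "comb (\<lambda>s. if s = t then 1 else 0) = t" 
      using R(2) t(1) by (intro ext) simp
    thus "X \<in> W" unfolding W_def t(2) by (metis rangeI)
  qed
  ultimately have "K \<subseteq> W" unfolding T(3) lie_span_def by blast
  hence "\<exists>c. outer_class (Y m) = outer_class (comb c)" for m using Y(2)[of m] W_def by blast
  hence "\<exists>c a. \<forall>x. Y m x = comb c x + commutator a x" for m
    using outer_class_eq_imp[OF Y(1)] by metis
  then obtain c a where ca: "\<And>m x. Y m x = comb (c m) x + commutator (a m) x" by metis
  define r where "r = card R"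
  obtain d where d: "\<exists>m\<in>{..r}. d m \<noteq> 0" "\<And>t. t \<in> R \<Longrightarrow> (\<Sum>m\<le>r. c m t * d m) = 0"
    using homogeneous_system_nontrivial[OF R(2), of "{..r}" "\<lambda>t m. c m t"] r_def by auto
  have "(\<Sum>m\<le>r. d m *s Y m x) = commutator (\<Sum>m\<le>r. d m *s a m) x" for x
  proof -
    have "(\<Sum>m\<le>r. d m *s comb (c m) x) = (\<Sum>m\<le>r. \<Sum>t\<in>R. (c m t * d m) *s t x)"
      by (simp add: comb_def scale_sum_right mult.commute)
    also have "\<dots> = (\<Sum>t\<in>R. (\<Sum>m\<le>r. c m t * d m) *s t x)"
      by (subst sum.swap) (simp add: scale_sum_left)
    also have "\<dots> = 0" by (simp add: d(2))
    finally show ?thesis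
      by (simp add: ca scale_right_distrib sum.distrib commutator_sum_left commutator_scale_left)
  qed
  thus thesis using that[of r d] d(1) by auto
qed

end

section \<open>Outer derivations are not locally finite-dimensional\<close>

context locally_matrix_algebra
begin

lemma not_locally_finite_dimensional_Outder:
  assumes countable_dimensional
  shows "\<not> locally_finite_dimensional Outder"
proof
  assume lfd: "locally_finite_dimensional Outder"
  obtain U :: "nat \<Rightarrow> nat \<Rightarrow> nat \<Rightarrow> 'b" where U: "\<And>i. matrix_units (Suc i) (U i)"
    and UU: "\<And>i j p q r s. i \<noteq> j \<Longrightarrow> p \<le> i \<Longrightarrow> q \<le> i \<Longrightarrow> r \<le> j \<Longrightarrow> s \<le> j \<Longrightarrow>
       commutator (U i p q) (U j r s) = 0"
    and Ux: "\<And>x. \<exists>l. \<forall>i\<ge>l. \<forall>p\<le>i. \<forall>q\<le>i. commutator (U i p q) x = 0"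
    using commuting_matrix_units_sequence[OF assms] by metis
  define a where "a i = shift i (U i)" for i
  define y where "y m i = iterated i (U i) m" for m i
  have y_simps: "y 0 i = U i 0 i" "y (Suc m) i = commutator (a i) (y m i)" for m i
    by (simp_all add: y_def a_def)
  \<comment> \<open>\<open>a i\<close> and \<open>y m i\<close> lie in the algebra generated by \<open>U i\<close>, so they commute with whatever \<open>U i\<close> does.\<close>
  have a0: "commutator (a i) x = 0" if "\<And>p q. p \<le> i \<Longrightarrow> q \<le> i \<Longrightarrow> commutator (U i p q) x = 0" for i x
    using that by (simp add: a_def shift_def commutator_sum_left)
  have y0: "commutator (y m i) x = 0"
    if "\<And>p q. p \<le> i \<Longrightarrow> q \<le> i \<Longrightarrow> commutator (U i p q) x = 0" for m i x
    using that by (induction m) (simp_all add: y_simps commutator_jacobi a0)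
  have locfin: "locally_finite_family f"
    if "\<And>i x. (\<And>p q. p \<le> i \<Longrightarrow> q \<le> i \<Longrightarrow> commutator (U i p q) x = 0) \<Longrightarrow> commutator (f i) x = 0"
    for f
    unfolding locally_finite_family_def
  proof
    fix x
    obtain l where "\<forall>i\<ge>l. \<forall>p\<le>i. \<forall>q\<le>i. commutator (U i p q) x = 0" using Ux by blast
    hence "{i. commutator (f i) x \<noteq> 0} \<subseteq> {..<l}" using that by (force simp: not_le)
    thus "finite {i. commutator (f i) x \<noteq> 0}" by (rule finite_subset) simp
  qed
  have lfa: "locally_finite_family a" using a0 by (rule locfin)
  have lfy: "locally_finite_family (y m)" for m using y0 by (rule locfin)
  have Uy: "commutator (U i p q) (y m j) = 0" if "i \<noteq> j" "p \<le> i" "q \<le> i" for i j p q m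
    using y0[of j "U i p q" m] UU that commutator_eq_0_sym by metis
  have ay: "commutator (a i) (y m j) = 0" if "i \<noteq> j" for i j m
    using a0 Uy that by blast
  interpret lie_algebra Der by (rule lie_algebra_Der)
  note Q = lie_quotient_simps[OF lie_ideal_Inder, folded Outder_def]
  have DA: "sum_ad a \<in> lcarrier Der" and DY: "sum_ad (y m) \<in> lcarrier Der" for m
    using derivation_sum_ad lfa lfy by (auto simp: Der_def)
  let ?S = "{outer_class (sum_ad a), outer_class (sum_ad (y 0))}"
  let ?K = "lie_generated Outder ?S"
  have fd: "lie_finite_dimensional Outder ?K"
    using lfd DA DY unfolding locally_finite_dimensional_def by (simp add: Q(1))
  have "outer_class (sum_ad (y m)) \<in> K" if K: "lie_subalgebra Outder K" "?S \<subseteq> K" for K m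
  proof (induction m)
    case (Suc m)
    have "lbracket Der (sum_ad a) (sum_ad (y m)) = sum_ad (y (Suc m))"
      using bracket_sum_ad[OF lfa lfy ay, of m]
      by (simp add: Der_def ext[of "y (Suc m)", OF y_simps(2)])
    hence "outer_class (sum_ad (y (Suc m))) =
        lbracket Outder (outer_class (sum_ad a)) (outer_class (sum_ad (y m)))"
      using Q(5)[OF DA DY] by simp
    thus ?case using K Suc unfolding lie_subalgebra_def by simp
  qed (use K in simp)
  hence YK: "outer_class (sum_ad (y m)) \<in> ?K" for m unfolding lie_generated_def by blast
  obtain r d z where nz: "\<exists>m\<le>r. d m \<noteq> 0"
    and rel: "\<And>x. (\<Sum>m\<le>r. d m *s sum_ad (y m) x) = commutator z x"
    by (rule finite_dimensional_outer_relation
        [where Y = "\<lambda>m. sum_ad (y m)", OF fd derivation_sum_ad[OF lfy] YK])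
      (rule that)
  \<comment> \<open>Evaluate at \<open>U i i i\<close> with \<open>i\<close> so large that \<open>z\<close> commutes with it and that the system has room for
    \<open>r\<close> shifts; the summands with index other than \<open>i\<close> vanish there.\<close>
  obtain l where l: "\<forall>i\<ge>l. \<forall>p\<le>i. \<forall>q\<le>i. commutator (U i p q) z = 0" using Ux by blast
  define i where "i = max l (Suc r)"
  have "sum_ad (y m) (U i i i) = commutator (y m i) (U i i i)" for m
    using sum_ad_eq[of "{i}" "y m" "U i i i"] commutator_eq_0_sym[OF Uy] by simp
  hence "commutator (\<Sum>m\<le>r. d m *s y m i) (U i i i) = (\<Sum>m\<le>r. d m *s sum_ad (y m) (U i i i))"
    by (simp add: commutator_sum_left commutator_scale_left)
  also have "\<dots> = 0"
    unfolding rel by (rule commutator_eq_0_sym) (use l in \<open>simp add: i_def\<close>)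
  finally show False
    using iterated_independent[OF U[of i], of r d] nz by (auto simp: y_def i_def)
qed

end

theorem theorem3:
  fixes scale :: "'f::field \<Rightarrow> 'a::ring \<Rightarrow> 'a"
  assumes "locally_matrix_algebra scale"
    and "assoc_algebra.countable_dimensional scale"
  shows "\<not> locally_finite_dimensional (assoc_algebra.Outder scale)"
  using locally_matrix_algebra.not_locally_finite_dimensional_Outder assms by blast

end
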